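(* Let $X=\{-1,1\}^{\mathbb N}$, $h\in\mathbb R$, and let $(a_k)_{k\ge1}$ satisfy $a_k\ge0$ and $\sum_{k\ge1}a_k<\infty$. Let $A(x)=hx_0+x_0\sum_{k\ge1}a_kx_k$, and let $\mu^{+},\mu^{-}$ be the Borel probability measures on $X$ determined by $$\int_X\varphi\,d\mu^{\pm}=\lim_{n\to\infty}\frac{\mathscr L_A^n(\varphi)(\pm1^\infty)}{\mathscr L_A^n(1)(\pm1^\infty)}\qquad\text{for all }\varphi\in\mathscr A .$$ Then $$\mu^{+}=\mu^{-}\quad\Longleftrightarrow\quad\int_Xx_i\,d\mu^{+}(x)=\int_Xx_i\,d\mu^{-}(x)\ \text{ for all }i\in\mathbb N .$$
   Context: $\mathbb N=\{0,1,2,\dots\}$; $1^\infty=(1,1,\dots)$, $-1^\infty=(-1,-1,\dots)$. The Ruelle operator is $\mathscr L_A(f)(x)=\sum_{i\in\{-1,1\}}e^{A(i,x_0,x_1,\dots)}f(i,x_0,x_1,\dots)$ on $C(X)$. For finite $B\subset\mathbb N$, $\varphi_B(x)=\prod_{i\in B}\frac12(1+x_i)$ (with $\varphi_\emptyset\equiv1$), and $\mathscr A$ is the algebra of all finite real linear combinations of the $\varphi_B$; it is dense in $C(X)$. For the potentials considered the displayed limits exist for all $\varphi\in\mathscr A$ and define unique Borel probability measures $\mu^\pm$. *)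

theory Defs
  imports "HOL-Probability.Probability"
begin

text \<open>
  The space \<open>{-1,1}\<^sup>\<nat>\<close> is a subset of \<^typ>\<open>nat \<Rightarrow> real\<close>, whose library topology is the product
  topology, so \<open>restrict_space borel X\<close> carries the Borel sets of the compact space \<open>X\<close>.
  Potentials and observables are functions on the whole of \<^typ>\<open>nat \<Rightarrow> real\<close>; since \<open>X\<close> is closed
  under prepending a spin, everything evaluated at a point of \<open>X\<close> depends only on their
  restriction to \<open>X\<close>.
\<close>

definition X :: "(nat \<Rightarrow> real) set" where
  "X = {x. \<forall>i. x i \<in> {-1, 1}}"

text \<open>\<open>case_nat i x\<close> is the sequence \<open>(i, x\<^sub>0, x\<^sub>1, \<dots>)\<close>.\<close>

definition ruelle ::
  "((nat \<Rightarrow> real) \<Rightarrow> real) \<Rightarrow> ((nat \<Rightarrow> real) \<Rightarrow> real) \<Rightarrow> (nat \<Rightarrow> real) \<Rightarrow> real" where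
  "ruelle A f x = (\<Sum>i\<in>{-1, 1}. exp (A (case_nat i x)) * f (case_nat i x))"

text \<open>Only the coefficients \<open>a k\<close> with \<open>k \<ge> 1\<close> enter; \<open>a 0\<close> is irrelevant.\<close>

definition potential :: "real \<Rightarrow> (nat \<Rightarrow> real) \<Rightarrow> (nat \<Rightarrow> real) \<Rightarrow> real" where
  "potential h a x = h * x 0 + x 0 * (\<Sum>k. a (Suc k) * x (Suc k))"

definition phi :: "nat set \<Rightarrow> (nat \<Rightarrow> real) \<Rightarrow> real" where
  "phi B x = (\<Prod>i\<in>B. 1/2 * (1 + x i))"

definition phi_algebra :: "((nat \<Rightarrow> real) \<Rightarrow> real) set" where
  "phi_algebra =
     {(\<lambda>x. \<Sum>B\<in>F. c B * phi B x) | F c. finite F \<and> (\<forall>B\<in>F. finite B)}"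

definition borel_prob_on_X :: "(nat \<Rightarrow> real) measure \<Rightarrow> bool" where
  "borel_prob_on_X \<mu> \<longleftrightarrow> prob_space \<mu> \<and> sets \<mu> = sets (restrict_space borel X)"

definition is_limit_measure ::
  "((nat \<Rightarrow> real) \<Rightarrow> real) \<Rightarrow> (nat \<Rightarrow> real) \<Rightarrow> (nat \<Rightarrow> real) measure \<Rightarrow> bool" where
  "is_limit_measure A z \<mu> \<longleftrightarrow> borel_prob_on_X \<mu> \<and>
     (\<forall>\<phi>\<in>phi_algebra.
        (\<lambda>n. (ruelle A ^^ n) \<phi> z / (ruelle A ^^ n) (\<lambda>_. 1) z)
          \<longlonglongrightarrow> (\<integral>x. \<phi> x \<partial>\<mu>))"

end

theory Submission
  imports Defs
begin

text \<open>
  The potential is supermodular, so the four functions inequality of Ahlswede and Daykin passes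
  from \<open>f\<close> to \<open>\<L> f\<close>, one spin at a time. Evaluated at \<open>1\<^sup>\<infinity>\<close> and \<open>-1\<^sup>\<infinity>\<close>, whose join and meet they
  are themselves, it gives \<open>\<integral>f d\<mu>\<^sup>- \<le> \<integral>f d\<mu>\<^sup>+\<close> for every increasing \<open>f \<ge> 0\<close> in the algebra. Both
  \<open>\<phi>\<^sub>B\<close> and \<open>1 + (\<Sum>i\<in>B. \<phi>\<^bsub>{i}\<^esub>) - \<phi>\<^sub>B\<close> are increasing, so equality of the first moments forces
  \<open>\<integral>\<phi>\<^sub>B d\<mu>\<^sup>- = \<integral>\<phi>\<^sub>B d\<mu>\<^sup>+\<close>, and the \<open>\<phi>\<^sub>B\<close> are the indicators of a \<open>\<pi>\<close>-system generating the Borel sets.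
\<close>

section \<open>Lattice structure of the spin space and supermodularity of the potential\<close>

lemma X_memD: "x \<in> X \<Longrightarrow> x i = -1 \<or> x i = 1"
  by (auto simp: X_def)

lemma X_abs: "x \<in> X \<Longrightarrow> \<bar>x i\<bar> = 1"
  using X_memD[of x i] by auto

lemma case_nat_in_X: "\<lbrakk>i \<in> {-1, 1}; x \<in> X\<rbrakk> \<Longrightarrow> case_nat i x \<in> X"
  by (auto simp: X_def split: nat.splits)

lemma sup_in_X: "\<lbrakk>x \<in> X; y \<in> X\<rbrakk> \<Longrightarrow> sup x y \<in> X"
  by (auto simp: X_def sup_fun_def sup_real_def max_def)

lemma inf_in_X: "\<lbrakk>x \<in> X; y \<in> X\<rbrakk> \<Longrightarrow> inf x y \<in> X"
  by (auto simp: X_def inf_fun_def inf_real_def min_def)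

lemma sup_case_nat: "sup (case_nat i x) (case_nat j y) = case_nat (sup i j) (sup x y)"
  by (auto simp: fun_eq_iff split: nat.splits)

lemma inf_case_nat: "inf (case_nat i x) (case_nat j y) = case_nat (inf i j) (inf x y)"
  by (auto simp: fun_eq_iff split: nat.splits)

lemma summable_interaction:
  assumes "summable a" "\<And>k. 0 \<le> a k" "x \<in> X"
  shows "summable (\<lambda>k. a k * x (Suc k) :: real)"
  by (rule summable_comparison_test'[OF assms(1), of 0])
     (simp add: abs_mult X_abs[OF assms(3)] assms(2))

text \<open>The interaction sum \<open>J\<close> is modular, since join and meet only redistribute
  each pair of coordinates, and it is increasing because the couplings are nonnegative. Multiplying
  it by the spin at 0 turns this into supermodularity.\<close>

lemma potential_supermodular:
  assumes a: "\<forall>k\<ge>1. a k \<ge> 0" and s: "summable (\<lambda>k. a (Suc k))"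
    and x: "x \<in> X" and y: "y \<in> X"
  shows "potential h a x + potential h a y \<le> potential h a (sup x y) + potential h a (inf x y)"
proof -
  define J where "J x = (\<Sum>k. a (Suc k) * x (Suc k))" for x
  have pot: "potential h a x = x 0 * (h + J x)" for x
    by (simp add: potential_def J_def algebra_simps)
  have sm: "summable (\<lambda>k. a (Suc k) * z (Suc k))" if "z \<in> X" for z
    using summable_interaction[OF s _ that] a by simp
  have mono: "J u \<le> J v" if "u \<in> X" "v \<in> X" "u \<le> v" for u v
    unfolding J_def using that a by (intro suminf_le sm mult_left_mono) (auto simp: le_fun_def)
  have "J x + J y = (\<Sum>k. a (Suc k) * x (Suc k) + a (Suc k) * y (Suc k))"
    unfolding J_def by (rule suminf_add[OF sm[OF x] sm[OF y]])
  also have "\<dots> = (\<Sum>k. a (Suc k) * sup x y (Suc k) + a (Suc k) * inf x y (Suc k))"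
    by (rule suminf_cong)
      (simp add: sup_real_def inf_real_def max_def min_def)
  also have "\<dots> = J (sup x y) + J (inf x y)"
    unfolding J_def
    by (rule suminf_add[OF sm[OF sup_in_X[OF x y]] sm[OF inf_in_X[OF x y]], symmetric])
  finally have modular: "J x + J y = J (sup x y) + J (inf x y)" .
  have le: "J x \<le> J (sup x y)" "J y \<le> J (sup x y)"
    using x y by (auto intro!: mono sup_in_X)
  consider "x 0 = -1" "y 0 = -1" | "x 0 = -1" "y 0 = 1" | "x 0 = 1" "y 0 = -1" | "x 0 = 1" "y 0 = 1"
    using X_memD[OF x, of 0] X_memD[OF y, of 0] by blast
  then show ?thesis
    \<comment> \<open>Equal spins at 0 give equality by \<open>modular\<close>. If they differ, the
      right side minus the left side is \<open>2 * (J (sup x y) - J u)\<close>, where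
      \<open>u\<close> is the configuration with spin 1 at 0.\<close>
    by cases (use modular le in \<open>auto simp: pot algebra_simps sup_real_def inf_real_def\<close>)
qed

section \<open>The four functions inequality under the Ruelle operator\<close>

text \<open>This is the Ahlswede-Daykin inequality on a two-point lattice. The indices 0 and 1 stand
  for the lower and upper point, so both mixed products on the left share the bound
  \<open>\<gamma>1 * \<delta>0\<close>.\<close>

lemma four_functions_step:
  fixes \<alpha>0 \<alpha>1 \<beta>0 \<beta>1 \<gamma>0 \<gamma>1 \<delta>0 \<delta>1 :: real
  assumes nn: "0 \<le> \<alpha>0" "0 \<le> \<alpha>1" "0 \<le> \<beta>0" "0 \<le> \<beta>1" "0 \<le> \<gamma>0" "0 \<le> \<gamma>1" "0 \<le> \<delta>0" "0 \<le> \<delta>1"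
    and le: "\<alpha>0 * \<beta>0 \<le> \<gamma>0 * \<delta>0" "\<alpha>0 * \<beta>1 \<le> \<gamma>1 * \<delta>0" "\<alpha>1 * \<beta>0 \<le> \<gamma>1 * \<delta>0" "\<alpha>1 * \<beta>1 \<le> \<gamma>1 * \<delta>1"
  shows "(\<alpha>0 + \<alpha>1) * (\<beta>0 + \<beta>1) \<le> (\<gamma>0 + \<gamma>1) * (\<delta>0 + \<delta>1)"
proof -
  define p q r s where "p = \<alpha>0 * \<beta>1" and "q = \<alpha>1 * \<beta>0" and "r = \<gamma>1 * \<delta>0" and "s = \<gamma>0 * \<delta>1"
  note pqrs = p_def q_def r_def s_def
  have pos: "0 \<le> p" "0 \<le> q" "0 \<le> r" "0 \<le> s" "p \<le> r" "q \<le> r"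
    using nn le by (auto simp: pqrs)
  \<comment> \<open>The product of the two corner inequalities, regrouped. Expanding
    \<open>(r - p) * (r - q)\<close> then gives r(p + q) \<le> r^2 + pq \<le> r(r + s).\<close>
  have "p * q \<le> r * s"
    using mult_mono[OF le(1) le(4)] nn by (simp add: pqrs mult_ac)
  moreover have "0 \<le> (r - p) * (r - q)"
    using pos by simp
  ultimately have "r * (p + q) \<le> r * (r + s)"
    by (simp add: algebra_simps)
  then have "p + q \<le> r + s"
    \<comment> \<open>If \<open>r\<close> is 0, then so are \<open>p\<close> and \<open>q\<close>,
      which lie between 0 and \<open>r\<close>; otherwise \<open>r\<close> cancels.\<close>
    using pos by (cases "r = 0") auto
  then show ?thesis
    using le(1,4) by (simp add: pqrs algebra_simps)
qed

text \<open>The hypothesis of the Ahlswede-Daykin theorem. Nonnegativity is included so that the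
  whole condition can be iterated.\<close>

definition four_fun ::
  "('a::lattice) set \<Rightarrow> ('a \<Rightarrow> real) \<Rightarrow> ('a \<Rightarrow> real) \<Rightarrow> ('a \<Rightarrow> real) \<Rightarrow> ('a \<Rightarrow> real) \<Rightarrow> bool" where
  "four_fun S f1 f2 f3 f4 \<longleftrightarrow>
     (\<forall>x\<in>S. 0 \<le> f1 x \<and> 0 \<le> f2 x \<and> 0 \<le> f3 x \<and> 0 \<le> f4 x) \<and>
     (\<forall>x\<in>S. \<forall>y\<in>S. f1 x * f2 y \<le> f3 (sup x y) * f4 (inf x y))"

text \<open>Prepending spins commutes with join and meet, so supermodularity of \<open>A\<close>
  gives the inequality for each pair of prepended spins. Summing over these pairs is exactly
  \<open>four_functions_step\<close>.\<close>

lemma four_fun_ruelle: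
  assumes A: "\<And>x y. x \<in> X \<Longrightarrow> y \<in> X \<Longrightarrow> A x + A y \<le> A (sup x y) + A (inf x y)"
    and f: "four_fun X f1 f2 f3 f4"
  shows "four_fun X (ruelle A f1) (ruelle A f2) (ruelle A f3) (ruelle A f4)"
proof -
  have nn: "0 \<le> f1 x" "0 \<le> f2 x" "0 \<le> f3 x" "0 \<le> f4 x" if "x \<in> X" for x
    using f that by (auto simp: four_fun_def)
  define g where "g f i x = exp (A (case_nat i x)) * f (case_nat i x)" for f i x
  have R: "ruelle A f x = g f (-1) x + g f 1 x" for f x
    by (simp add: ruelle_def g_def)
  have g: "g f1 i x * g f2 j y \<le> g f3 (sup i j) (sup x y) * g f4 (inf i j) (inf x y)"
    if "i \<in> {-1, 1}" "j \<in> {-1, 1}" "x \<in> X" "y \<in> X" for i j x y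
  proof -
    have X: "case_nat i x \<in> X" "case_nat j y \<in> X"
      using that by (auto intro!: case_nat_in_X)
    have "exp (A (case_nat i x) + A (case_nat j y)) * (f1 (case_nat i x) * f2 (case_nat j y))
        \<le> exp (A (sup (case_nat i x) (case_nat j y)) + A (inf (case_nat i x) (case_nat j y)))
          * (f3 (sup (case_nat i x) (case_nat j y)) * f4 (inf (case_nat i x) (case_nat j y)))"
      using X f nn[OF X(1)] nn[OF X(2)]
      by (intro mult_mono[of "exp _" "exp _"]) (auto simp: A four_fun_def)
    then show ?thesis
      by (simp add: g_def exp_add sup_case_nat inf_case_nat mult_ac)
  qed
  have gnn: "0 \<le> g f1 i x" "0 \<le> g f2 i x" "0 \<le> g f3 i x" "0 \<le> g f4 i x"
    if "i \<in> {-1, 1}" "x \<in> X" for i x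
    using nn[OF case_nat_in_X[OF that]] by (auto simp: g_def)
  have "ruelle A f1 x * ruelle A f2 y \<le> ruelle A f3 (sup x y) * ruelle A f4 (inf x y)"
    if "x \<in> X" "y \<in> X" for x y
    unfolding R
    using g[of "-1" "-1" x y] g[of "-1" 1 x y] g[of 1 "-1" x y] g[of 1 1 x y]
      that sup_in_X[OF that] inf_in_X[OF that]
    by (intro four_functions_step gnn) (simp_all add: sup_real_def inf_real_def)
  then show ?thesis
    using gnn by (simp add: four_fun_def R)
qed

lemma ruelle_pow_pos:
  assumes "\<And>x. x \<in> X \<Longrightarrow> 0 < f x" "x \<in> X"
  shows "0 < (ruelle A ^^ n) f x"
  using assms(2)
proof (induction n arbitrary: x)
  case (Suc n)
  then show ?case
    by (auto simp: ruelle_def intro!: add_pos_pos mult_pos_pos Suc.IH case_nat_in_X)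
qed (use assms in simp)

text \<open>A correlation inequality of Holley type: the quadruple \<open>1, f, f, 1\<close>
  satisfies the four functions condition because \<open>f\<close> is increasing, and the operator
  preserves that condition.\<close>

lemma ruelle_average_mono:
  assumes A: "\<And>x y. x \<in> X \<Longrightarrow> y \<in> X \<Longrightarrow> A x + A y \<le> A (sup x y) + A (inf x y)"
    and nn: "\<And>x. x \<in> X \<Longrightarrow> 0 \<le> f x" and mono: "mono_on X f"
    and zw: "z \<in> X" "w \<in> X" "z \<le> w"
  shows "(ruelle A ^^ n) f z / (ruelle A ^^ n) (\<lambda>_. 1) z
       \<le> (ruelle A ^^ n) f w / (ruelle A ^^ n) (\<lambda>_. 1) w"
proof -
  have "four_fun X ((ruelle A ^^ n) (\<lambda>_. 1)) ((ruelle A ^^ n) f)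
      ((ruelle A ^^ n) f) ((ruelle A ^^ n) (\<lambda>_. 1))"
  proof (induction n)
    case 0
    have "f y \<le> f (sup x y)" if "x \<in> X" "y \<in> X" for x y
      using that sup_in_X[OF that] by (intro mono_onD[OF mono]) auto
    then show ?case
      using nn by (simp add: four_fun_def)
  next
    case (Suc n)
    show ?case
      unfolding funpow.simps o_apply using A Suc.IH by (rule four_fun_ruelle)
  qed
  \<comment> \<open>With the larger point in the first slot, join and meet return \<open>w\<close>
    and \<open>z\<close>, which leaves the claim with its denominators cleared.\<close>
  then have "(ruelle A ^^ n) (\<lambda>_. 1) w * (ruelle A ^^ n) f z
      \<le> (ruelle A ^^ n) f (sup w z) * (ruelle A ^^ n) (\<lambda>_. 1) (inf w z)"
    using zw by (auto simp: four_fun_def)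
  moreover have "sup w z = w" "inf w z = z"
    using zw(3) by (auto intro: sup_absorb1 inf_absorb2)
  moreover have "0 < (ruelle A ^^ n) (\<lambda>_. 1) w" "0 < (ruelle A ^^ n) (\<lambda>_. 1) z"
    using zw by (auto intro!: ruelle_pow_pos)
  ultimately show ?thesis
    by (simp add: pos_divide_le_eq pos_le_divide_eq mult.commute)
qed

section \<open>Increasing functions in the algebra\<close>

lemma phi_factor_bounds: "x \<in> X \<Longrightarrow> 0 \<le> 1/2 * (1 + x i) \<and> 1/2 * (1 + x i) \<le> 1"
  using X_memD[of x i] by auto

lemma phi_bounds:
  assumes "x \<in> X"
  shows "0 \<le> phi B x" "phi B x \<le> 1"
  unfolding phi_def using phi_factor_bounds[OF assms]
  by (blast intro: prod_nonneg prod_le_1)+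

lemma phi_mono: "mono_on X (phi B)"
proof (rule mono_onI)
  fix x y assume xy: "x \<in> X" "y \<in> X" "x \<le> y"
  then have "x i \<le> y i" for i
    by (simp add: le_fun_def)
  then show "phi B x \<le> phi B y"
    unfolding phi_def using phi_factor_bounds[OF xy(1)] by (intro prod_mono) auto
qed

text \<open>A product of factors in [0,1] grows by at most the sum of the growths of its factors.
  The summand 1 makes the function nonnegative on \<open>X\<close>, as the comparison of limits
  requires.\<close>

lemma phi_defect_mono: "mono_on X (\<lambda>x. 1 + (\<Sum>i\<in>B. phi {i} x) - phi B x)"
proof (rule mono_onI)
  fix x y assume xy: "x \<in> X" "y \<in> X" "x \<le> y"
  have u: "norm (phi {i} x) \<le> 1" "norm (phi {i} y) \<le> 1" for i
    using phi_bounds xy by auto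
  have P: "phi B z = (\<Prod>i\<in>B. phi {i} z)" for z
    by (simp add: phi_def)
  have "phi B y - phi B x \<le> norm ((\<Prod>i\<in>B. phi {i} y) - (\<Prod>i\<in>B. phi {i} x))"
    by (simp add: P)
  also have "\<dots> \<le> (\<Sum>i\<in>B. norm (phi {i} y - phi {i} x))"
    by (rule norm_prod_diff) (use u in auto)
  also have "\<dots> = (\<Sum>i\<in>B. phi {i} y - phi {i} x)"
    using mono_onD[OF phi_mono xy] by (intro sum.cong) auto
  finally show "1 + (\<Sum>i\<in>B. phi {i} x) - phi B x \<le> 1 + (\<Sum>i\<in>B. phi {i} y) - phi B y"
    by (simp add: sum_subtractf)
qed

lemma phi_in_algebra:
  assumes "finite B"
  shows "phi B \<in> phi_algebra"
  unfolding phi_algebra_def using assms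
  by (auto intro!: exI[of _ "{B}"] exI[of _ "\<lambda>_. 1"])

lemma phi_defect_in_algebra:
  assumes "finite B"
  shows "(\<lambda>x. 1 + (\<Sum>i\<in>B. phi {i} x) - phi B x) \<in> phi_algebra"
proof -
  define G where "G = (\<lambda>i. {i}) ` B"
  define F where "F = insert B (insert {} G)"
  \<comment> \<open>Each index set carries a single coefficient, so contributions are added: this
    covers the coincidences when \<open>B\<close> is empty or a singleton.\<close>
  define c :: "nat set \<Rightarrow> real"
    where "c C = of_bool (C = {}) + of_bool (C \<in> G) - of_bool (C = B)" for C
  have fin: "finite F"
    using assms by (simp add: F_def G_def)
  have "(\<Sum>C\<in>F. c C * phi C x) = 1 + (\<Sum>i\<in>B. phi {i} x) - phi B x" for x
  proof -
    have "(\<Sum>C\<in>F. c C * phi C x) = (\<Sum>C\<in>F. if C = {} then phi C x else 0)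
        + (\<Sum>C\<in>F. if C \<in> G then phi C x else 0) - (\<Sum>C\<in>F. if C = B then phi C x else 0)"
      unfolding sum.distrib[symmetric] sum_subtractf[symmetric]
      by (intro sum.cong) (auto simp: c_def algebra_simps)
    moreover have "(\<Sum>C\<in>F. if C \<in> G then phi C x else 0) = (\<Sum>C\<in>G. phi C x)"
      using fin by (simp add: sum.If_cases) (rule arg_cong2[where f=sum], auto simp: F_def)
    moreover have "(\<Sum>C\<in>G. phi C x) = (\<Sum>i\<in>B. phi {i} x)"
      unfolding G_def by (subst sum.reindex) (auto simp: inj_on_def)
    moreover have "phi {} x = 1"
      by (simp add: phi_def)
    moreover have "{} \<in> F" "B \<in> F"
      by (auto simp: F_def)
    ultimately show ?thesis
      using fin by simp
  qed
  moreover have "\<forall>C\<in>F. finite C"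
    using assms by (auto simp: F_def G_def)
  ultimately show ?thesis
    unfolding phi_algebra_def using fin by (force intro!: exI[of _ F] exI[of _ c])
qed

section \<open>Borel probability measures are determined by the integrals of
  \<open>phi B\<close>\<close>

lemma space_borel_prob_on_X: "borel_prob_on_X \<mu> \<Longrightarrow> space \<mu> = X"
  by (auto simp: borel_prob_on_X_def space_restrict_space dest: sets_eq_imp_space_eq)

lemma coord_measurable:
  assumes "borel_prob_on_X \<mu>"
  shows "(\<lambda>x. x i) \<in> borel_measurable \<mu>"
proof -
  have "(\<lambda>x::nat \<Rightarrow> real. x i) \<in> borel_measurable (restrict_space borel X)"
    by (intro measurable_restrict_space1 borel_measurable_continuous_onI continuous_on_product_coordinates)
  then show ?thesis
    using assms measurable_cong_sets[of \<mu> "restrict_space borel X" borel borel]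
    by (auto simp: borel_prob_on_X_def)
qed

lemma integrable_coord:
  assumes "borel_prob_on_X \<mu>"
  shows "integrable \<mu> (\<lambda>x. x i)"
proof -
  interpret prob_space \<mu> using assms by (simp add: borel_prob_on_X_def)
  show ?thesis
    using coord_measurable[OF assms] X_abs
    by (intro integrable_const_bound[of _ 1]) (auto simp: space_borel_prob_on_X[OF assms])
qed

lemma integrable_phi:
  assumes "borel_prob_on_X \<mu>"
  shows "integrable \<mu> (phi B)"
proof -
  interpret prob_space \<mu> using assms by (simp add: borel_prob_on_X_def)
  note [measurable] = coord_measurable[OF assms]
  have "phi B \<in> borel_measurable \<mu>"
    unfolding phi_def by measurable
  then show ?thesis
    using phi_bounds
    by (intro integrable_const_bound[of _ 1]) (auto simp: space_borel_prob_on_X[OF assms])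
qed

definition up_cylinder :: "nat set \<Rightarrow> (nat \<Rightarrow> real) set" where
  "up_cylinder B = {x \<in> X. \<forall>i\<in>B. x i = 1}"

lemma phi_eq_indicator:
  assumes "finite B" "x \<in> X"
  shows "phi B x = indicator (up_cylinder B) x"
proof (cases "\<forall>i\<in>B. x i = 1")
  case True
  then show ?thesis
    using assms by (simp add: phi_def up_cylinder_def)
next
  case False
  then obtain i where "i \<in> B" "1 + x i = 0"
    using X_memD[OF assms(2)] by force
  then have "phi B x = 0"
    unfolding phi_def using assms(1) by (intro prod_zero) auto
  then show ?thesis
    using False by (simp add: up_cylinder_def)
qed

text \<open>On \<open>X\<close> each coordinate is an affine function of the indicator of
  \<open>up_cylinder {i}\<close>, so these sets make all coordinates measurable. The Borel sets of
  the countable product are generated by the coordinates.\<close>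

lemma sets_eq_sigma_up_cylinders:
  "sets (restrict_space borel X) = sigma_sets X (up_cylinder ` {B. finite B})"
proof
  let ?E = "up_cylinder ` {B. finite B}"
  define M where "M = sigma X ?E"
  have E: "?E \<subseteq> Pow X"
    by (auto simp: up_cylinder_def)
  have M: "space M = X" "sets M = sigma_sets X ?E"
    using E by (auto simp: M_def)
  have "(\<lambda>x. x i) \<in> borel_measurable M" for i :: nat
  proof -
    have *: "up_cylinder {i} \<in> sets M"
      unfolding M by (intro sigma_sets.Basic) auto
    have "(\<lambda>x. 2 * indicator (up_cylinder {i}) x - 1 :: real) \<in> borel_measurable M"
      using * by measurable
    moreover have "x i = 2 * indicator (up_cylinder {i}) x - 1" if "x \<in> space M" for x
      using that X_memD[of x i] by (auto simp: M up_cylinder_def)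
    ultimately show ?thesis
      by (subst measurable_cong) auto
  qed
  then have "(\<lambda>x. x) \<in> measurable M (PiM UNIV (\<lambda>_. borel))"
    by (intro measurable_PiM_single') auto
  then have "(\<lambda>x. x) \<in> measurable M (borel :: (nat \<Rightarrow> real) measure)"
    by (simp cong: measurable_cong_sets add: sets_PiM_equal_borel)
  then have id: "(\<lambda>x. x) \<in> measurable M (restrict_space borel X)"
    by (intro measurable_restrict_space2) (auto simp: M)
  show "sets (restrict_space borel X) \<subseteq> sigma_sets X ?E"
  proof
    fix A assume A: "A \<in> sets (restrict_space borel X)"
    then have "A \<subseteq> X"
      using sets.sets_into_space by (force simp: space_restrict_space)
    \<comment> \<open>The preimage of \<open>A\<close> under the identity, cut down to
      \<open>X\<close>, is \<open>A\<close> itself.\<close>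
    then show "A \<in> sigma_sets X ?E"
      using measurable_sets[OF id A] by (simp add: M Int_absorb2)
  qed
next
  let ?R = "restrict_space borel X :: (nat \<Rightarrow> real) measure"
  have sp: "space ?R = X"
    by (simp add: space_restrict_space)
  have "up_cylinder B \<in> sets ?R" if "finite B" for B
  proof -
    have [measurable]: "(\<lambda>x::nat \<Rightarrow> real. x i) \<in> borel_measurable ?R" for i
      by (intro measurable_restrict_space1 borel_measurable_continuous_onI continuous_on_product_coordinates)
    have "{x \<in> space ?R. \<forall>i\<in>B. x i = 1} \<in> sets ?R"
      using that by measurable
    then show ?thesis
      by (simp add: up_cylinder_def sp)
  qed
  then have "sigma_sets (space ?R) (up_cylinder ` {B. finite B}) \<subseteq> sets ?R"
    by (intro sets.sigma_sets_subset) auto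
  then show "sigma_sets X (up_cylinder ` {B. finite B}) \<subseteq> sets ?R"
    by (simp only: sp)
qed

text \<open>The integral of \<open>phi B\<close> is the mass of \<open>up_cylinder B\<close>, and
  intersecting two such sets unites their index sets, so they form a generating
  \<pi>-system.\<close>

lemma borel_prob_on_X_eqI:
  assumes \<mu>: "borel_prob_on_X \<mu>" and \<nu>: "borel_prob_on_X \<nu>"
    and eq: "\<And>B. finite B \<Longrightarrow> (\<integral>x. phi B x \<partial>\<mu>) = (\<integral>x. phi B x \<partial>\<nu>)"
  shows "\<mu> = \<nu>"
proof -
  let ?E = "up_cylinder ` {B. finite B}"
  have sets: "sets \<mu> = sigma_sets X ?E" "sets \<nu> = sigma_sets X ?E"
    using \<mu> \<nu> by (auto simp: borel_prob_on_X_def sets_eq_sigma_up_cylinders)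
  have emeasure: "emeasure \<rho> (up_cylinder B) = ennreal (\<integral>x. phi B x \<partial>\<rho>)"
    if \<rho>: "borel_prob_on_X \<rho>" and B: "finite B" for \<rho> B
  proof -
    interpret prob_space \<rho> using \<rho> by (simp add: borel_prob_on_X_def)
    have "up_cylinder B \<in> sets \<rho>"
      using \<rho> B by (auto simp: borel_prob_on_X_def sets_eq_sigma_up_cylinders)
    moreover have "(\<integral>x. phi B x \<partial>\<rho>) = (\<integral>x. indicator (up_cylinder B) x \<partial>\<rho>)"
      using phi_eq_indicator[OF B]
      by (intro Bochner_Integration.integral_cong) (auto simp: space_borel_prob_on_X[OF \<rho>])
    moreover have "up_cylinder B \<inter> space \<rho> = up_cylinder B"
      by (auto simp: space_borel_prob_on_X[OF \<rho>] up_cylinder_def)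
    ultimately show ?thesis
      by (simp add: emeasure_eq_measure)
  qed
  have "up_cylinder B \<inter> up_cylinder C = up_cylinder (B \<union> C)" for B C
    by (auto simp: up_cylinder_def)
  then have "Int_stable ?E"
    by (auto simp: Int_stable_def)
  then show ?thesis
  proof (rule measure_eqI_generator_eq[where A = "\<lambda>_. X" and \<Omega> = X])
    \<comment> \<open>The whole space belongs to the generator, so a constant sequence serves as the
      exhausting cover of finite mass.\<close>
    have "X = up_cylinder {}"
      by (simp add: up_cylinder_def)
    then show "range (\<lambda>_::nat. X) \<subseteq> ?E"
      by auto
    interpret prob_space \<mu> using \<mu> by (simp add: borel_prob_on_X_def)
    show "emeasure \<mu> X \<noteq> \<infinity>"
      by simp
    show "?E \<subseteq> Pow X"
      by (auto simp: up_cylinder_def)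
  qed (auto simp: sets emeasure[OF \<mu>] emeasure[OF \<nu>] eq)
qed

section \<open>Comparison of the two limit measures\<close>

lemma limit_measure_mono:
  assumes A: "\<And>x y. x \<in> X \<Longrightarrow> y \<in> X \<Longrightarrow> A x + A y \<le> A (sup x y) + A (inf x y)"
    and \<mu>: "is_limit_measure A z \<mu>" and \<nu>: "is_limit_measure A w \<nu>"
    and zw: "z \<in> X" "w \<in> X" "z \<le> w"
    and f: "f \<in> phi_algebra" "\<And>x. x \<in> X \<Longrightarrow> 0 \<le> f x" "mono_on X f"
  shows "(\<integral>x. f x \<partial>\<mu>) \<le> (\<integral>x. f x \<partial>\<nu>)"
proof (rule LIMSEQ_le)
  show "(\<lambda>n. (ruelle A ^^ n) f z / (ruelle A ^^ n) (\<lambda>_. 1) z) \<longlonglongrightarrow> (\<integral>x. f x \<partial>\<mu>)"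
    "(\<lambda>n. (ruelle A ^^ n) f w / (ruelle A ^^ n) (\<lambda>_. 1) w) \<longlonglongrightarrow> (\<integral>x. f x \<partial>\<nu>)"
    using \<mu> \<nu> f(1) by (auto simp: is_limit_measure_def)
qed (use ruelle_average_mono[OF A f(2,3) zw] in blast)

theorem theorem3:
  fixes h :: real and a :: "nat \<Rightarrow> real" and \<mu>p \<mu>m :: "(nat \<Rightarrow> real) measure"
  assumes "\<forall>k\<ge>1. a k \<ge> 0"
    and "summable (\<lambda>k. a (Suc k))"
    and "is_limit_measure (potential h a) (\<lambda>_. 1) \<mu>p"
    and "is_limit_measure (potential h a) (\<lambda>_. -1) \<mu>m"
  shows "\<mu>p = \<mu>m \<longleftrightarrow> (\<forall>i. (\<integral>x. x i \<partial>\<mu>p) = (\<integral>x. x i \<partial>\<mu>m))"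
proof
  assume eq: "\<forall>i. (\<integral>x. x i \<partial>\<mu>p) = (\<integral>x. x i \<partial>\<mu>m)"
  have b: "borel_prob_on_X \<mu>p" "borel_prob_on_X \<mu>m"
    using assms(3,4) by (auto simp: is_limit_measure_def)
  have le: "(\<integral>x. f x \<partial>\<mu>m) \<le> (\<integral>x. f x \<partial>\<mu>p)"
    if "f \<in> phi_algebra" "\<And>x. x \<in> X \<Longrightarrow> 0 \<le> f x" "mono_on X f" for f
    \<comment> \<open>The two base points are the bottom and the top of \<open>X\<close>; the bottom
      one comes first, hence the order of the assumptions.\<close>
    by (rule limit_measure_mono[OF potential_supermodular[OF assms(1,2)] assms(4,3)])
       (use that in \<open>auto simp: X_def le_fun_def\<close>)
  \<comment> \<open>Since \<open>phi {i}\<close> is affine in the coordinate, everything here except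
    the integral of \<open>phi B\<close> depends on the first moments alone.\<close>
  have defect: "(\<integral>x. 1 + (\<Sum>i\<in>B. phi {i} x) - phi B x \<partial>\<rho>)
      = 1 + (\<Sum>i\<in>B. (1 + (\<integral>x. x i \<partial>\<rho>)) / 2) - (\<integral>x. phi B x \<partial>\<rho>)"
    if \<rho>: "borel_prob_on_X \<rho>" for \<rho> B
  proof -
    interpret prob_space \<rho> using \<rho> by (simp add: borel_prob_on_X_def)
    have phi: "(\<integral>x. phi {i} x \<partial>\<rho>) = (1 + (\<integral>x. x i \<partial>\<rho>)) / 2" for i
      using integrable_coord[OF \<rho>] by (simp add: phi_def prob_space)
    then show ?thesis
      using integrable_phi[OF \<rho>] by (simp add: prob_space flip: phi)
  qed
  show "\<mu>p = \<mu>m"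
  proof (rule borel_prob_on_X_eqI[OF b])
    fix B :: "nat set" assume B: "finite B"
    have "(\<integral>x. phi B x \<partial>\<mu>m) \<le> (\<integral>x. phi B x \<partial>\<mu>p)"
      by (intro le phi_in_algebra B phi_mono phi_bounds)
    moreover have "0 \<le> 1 + (\<Sum>i\<in>B. phi {i} x) - phi B x" if "x \<in> X" for x
      using phi_bounds(2)[OF that, of B] sum_nonneg[of B "\<lambda>i. phi {i} x"] phi_bounds(1)[OF that]
      by force
    then have "(\<integral>x. 1 + (\<Sum>i\<in>B. phi {i} x) - phi B x \<partial>\<mu>m)
        \<le> (\<integral>x. 1 + (\<Sum>i\<in>B. phi {i} x) - phi B x \<partial>\<mu>p)"
      by (intro le phi_defect_in_algebra B phi_defect_mono)
    \<comment> \<open>Equal first moments cancel, and the minus sign before \<open>phi B\<close>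
      reverses the inequality.\<close>
    then have "(\<integral>x. phi B x \<partial>\<mu>p) \<le> (\<integral>x. phi B x \<partial>\<mu>m)"
      using eq by (simp add: defect b)
    ultimately show "(\<integral>x. phi B x \<partial>\<mu>p) = (\<integral>x. phi B x \<partial>\<mu>m)"
      by simp
  qed
qed simp

end
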